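(* There is no symmetric association scheme $\mathcal{A} = (X, \{R_0, R_1, R_2, R_3, R_4\})$ with $R_0 = \mathrm{Id}_X$ whose intersection numbers, written as matrices $(p^h_{ij})_{i,j=0}^4$ for $h = 0,\dots,4$ (rows indexed by $i$, columns by $j$), are: $(p^0_{ij}) = \mathrm{diag}(1, 12, 4, 4, 24)$; $(p^1_{ij})$ has rows $(0,1,0,0,0)$, $(1,3,2,0,6)$, $(0,2,0,0,2)$, $(0,0,0,0,4)$, $(0,6,2,4,12)$; $(p^2_{ij})$ has rows $(0,0,1,0,0)$, $(0,6,0,0,6)$, $(1,0,1,2,0)$, $(0,0,2,2,0)$, $(0,6,0,0,18)$; $(p^3_{ij})$ has rows $(0,0,0,1,0)$, $(0,0,0,0,12)$, $(0,0,2,2,0)$, $(1,0,2,1,0)$, $(0,12,0,0,12)$; $(p^4_{ij})$ has rows $(0,0,0,0,1)$, $(0,3,1,2,6)$, $(0,1,0,0,3)$, $(0,2,0,0,2)$, $(1,6,3,2,12)$.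
   Context: A symmetric association scheme is a pair $(X, \{R_i \mid i \in \mathcal{I}\})$ where $X$ is a finite set and the $R_i$ are nonempty symmetric binary relations on $X$ partitioning $X^2$, with $R_0$ the identity relation, such that for all $h,i,j$ there is a number $p^h_{ij}$ (intersection number) with the property that for every $(x,y) \in R_h$ there are exactly $p^h_{ij}$ vertices $z$ with $(x,z) \in R_i$ and $(z,y) \in R_j$. (Such a scheme would have $45$ vertices.) *)

theory Defs
  imports Main "HOL-Library.Disjoint_Sets"
begin

locale symmetric_association_scheme =
  fixes X :: "'a set" and I :: "'i::zero set" and R :: "'i \<Rightarrow> 'a rel"
  assumes finite_vertices: "finite X"
    and zero_index: "0 \<in> I"
    and nonempty: "\<And>i. i \<in> I \<Longrightarrow> R i \<noteq> {}"
    and symmetric: "\<And>i. i \<in> I \<Longrightarrow> sym (R i)"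
    and disjoint: "disjoint_family_on R I"
    and cover: "(\<Union>i\<in>I. R i) = X \<times> X"
    and identity: "R 0 = Id_on X"
    and regular: "\<And>h i j. h \<in> I \<Longrightarrow> i \<in> I \<Longrightarrow> j \<in> I \<Longrightarrow>
      \<exists>p. \<forall>(x, y) \<in> R h. card {z \<in> X. (x, z) \<in> R i \<and> (z, y) \<in> R j} = p"

(* p^h_{ij}; well defined in a scheme because R h is nonempty. *)
definition intersection_number :: "'a set \<Rightarrow> ('i \<Rightarrow> 'a rel) \<Rightarrow> 'i \<Rightarrow> 'i \<Rightarrow> 'i \<Rightarrow> nat" where
  "intersection_number X R h i j =
    (THE p. \<forall>(x, y) \<in> R h. card {z \<in> X. (x, z) \<in> R i \<and> (z, y) \<in> R j} = p)"

(* (p^h_{ij}) for i, j = 0, ..., d, as the list of its rows: i indexes rows, j columns. *)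
definition intersection_matrix :: "'a set \<Rightarrow> (nat \<Rightarrow> 'a rel) \<Rightarrow> nat \<Rightarrow> nat \<Rightarrow> nat list list" where
  "intersection_matrix X R d h =
    map (\<lambda>i. map (\<lambda>j. intersection_number X R h i j) [0..<Suc d]) [0..<Suc d]"

lemma (in symmetric_association_scheme) card_eq_intersection_number:
  assumes "h \<in> I" "i \<in> I" "j \<in> I" "(x, y) \<in> R h"
  shows "card {z \<in> X. (x, z) \<in> R i \<and> (z, y) \<in> R j} = intersection_number X R h i j"
proof -
  obtain p where p: "\<forall>(x, y) \<in> R h. card {z \<in> X. (x, z) \<in> R i \<and> (z, y) \<in> R j} = p"
    using regular[OF assms(1-3)] by blast
  have "intersection_number X R h i j = p"
    unfolding intersection_number_def using p assms(4) by (intro the_equality) auto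
  with p assms(4) show ?thesis by auto
qed

end

theory Submission
  imports Defs
begin

text \<open>
  The relations \<open>R 0\<close>, \<open>R 2\<close>, \<open>R 3\<close> form an equivalence with five classes (blocks) of size nine, and
  \<open>R 2\<close> makes each block a \<open>3 \<times> 3\<close> grid. The \<open>R 1\<close>-neighbours of a point in another block \<open>E\<close> form
  a line of that grid, whose direction depends only on the block \<open>C\<close> of the point. So \<open>E\<close> sorts the
  four other blocks by direction, and \<open>p\<^sup>2\<^sub>1\<^sub>1 = 6\<close> splits them two and two. On the other hand, \<open>p\<^sup>1\<^sub>1\<^sub>1 = p\<^sup>4\<^sub>1\<^sub>1 = 3\<close>
  forces two blocks to have the same direction either in all three remaining blocks or in none, which
  is impossible by counting modulo 3.
\<close>

text \<open>Symmetry of \<open>R j\<close> turns the triangle count of the definition into the size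
  of an intersection of two neighbourhoods, the form in which the matrix entries are used
  below.\<close>

lemma (in symmetric_association_scheme) card_nbhds_Int:
  assumes "h \<in> I" "i \<in> I" "j \<in> I" "(x, y) \<in> R h"
  shows "card (R i `` {x} \<inter> R j `` {y}) = intersection_number X R h i j"
proof -
  have "R i \<subseteq> X \<times> X"
    using cover \<open>i \<in> I\<close> by blast
  then have "R i `` {x} \<inter> R j `` {y} = {z \<in> X. (x, z) \<in> R i \<and> (z, y) \<in> R j}"
    using symmetric[OF \<open>j \<in> I\<close>] by (auto dest: symD)
  then show ?thesis
    using card_eq_intersection_number[OF assms] by simp
qed

lemma intersection_number_conv_matrix:
  assumes "i \<le> d" "j \<le> d"
  shows "intersection_number X R h i j = intersection_matrix X R d h ! i ! j"
  using assms unfolding intersection_matrix_def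
  by (simp del: upt_Suc add: nth_map)

text \<open>For a fixed \<open>C\<close> there are four pairs \<open>(D, E)\<close> with \<open>S E C D\<close>, one for each \<open>E\<close>, although every
  \<open>D\<close> contributes zero or three of them.\<close>

lemma no_pairing_system_on_five_points:
  fixes S :: "'b \<Rightarrow> 'b \<Rightarrow> 'b \<Rightarrow> bool"
  assumes "card V = 5"
    and partner: "\<And>C E. C \<in> V \<Longrightarrow> E \<in> V \<Longrightarrow> C \<noteq> E \<Longrightarrow> card {D \<in> V - {E} - {C}. S E C D} = 1"
    and all_or_none: "\<And>C D. C \<in> V \<Longrightarrow> D \<in> V \<Longrightarrow> C \<noteq> D \<Longrightarrow>
      card {E \<in> V - {C} - {D}. S E C D} \<in> {0, 3}"
  shows False
proof -
  have fin: "finite V"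
    using assms(1) card.infinite by fastforce
  let ?s = "\<lambda>C. \<Sum>D\<in>V-{C}. \<Sum>E\<in>V-{C}-{D}. of_bool (S E C D) :: nat"
  have s_alt: "?s C = 4" if "C \<in> V" for C
  proof -
    have "?s C = (\<Sum>E\<in>V-{C}. \<Sum>D\<in>V-{C}-{E}. of_bool (S E C D))"
    proof -
      \<comment> \<open>The inner range depends on \<open>D\<close>, so it is recast as a fixed set
        with a condition relating \<open>D\<close> and \<open>E\<close>, as
        \<open>sum.swap_restrict\<close> requires.\<close>
      have "?s C = (\<Sum>D\<in>V-{C}. \<Sum>E\<in>{E \<in> V-{C}. E \<noteq> D}. of_bool (S E C D))"
        by (intro sum.cong refl) auto
      also have "\<dots> = (\<Sum>E\<in>V-{C}. \<Sum>D\<in>{D \<in> V-{C}. E \<noteq> D}. of_bool (S E C D))"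
        using fin by (intro sum.swap_restrict) auto
      also have "\<dots> = (\<Sum>E\<in>V-{C}. \<Sum>D\<in>V-{C}-{E}. of_bool (S E C D))"
        by (intro sum.cong refl) auto
      finally show ?thesis .
    qed
    also have "\<dots> = (\<Sum>E\<in>V-{C}. 1)"
    proof (intro sum.cong refl)
      fix E assume E: "E \<in> V-{C}"
      have "(\<Sum>D\<in>V-{C}-{E}. of_bool (S E C D) :: nat) = card {D \<in> V-{C}-{E}. S E C D}"
        using fin by (simp add: of_bool_def sum.If_cases Int_def)
      also have "{D \<in> V-{C}-{E}. S E C D} = {D \<in> V-{E}-{C}. S E C D}"
        by auto
      finally show "(\<Sum>D\<in>V-{C}-{E}. of_bool (S E C D) :: nat) = 1"
        using partner[of C E] E that by auto
    qed
    finally show ?thesis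
      using fin that assms(1) by simp
  qed
  obtain C where C: "C \<in> V"
    using assms(1) by fastforce
  have "3 dvd ?s C"
  proof (rule dvd_sum)
    fix D assume D: "D \<in> V - {C}"
    have "(\<Sum>E\<in>V-{C}-{D}. of_bool (S E C D) :: nat) = card {E \<in> V-{C}-{D}. S E C D}"
      using fin by (simp add: of_bool_def sum.If_cases Int_def)
    then show "3 dvd (\<Sum>E\<in>V-{C}-{D}. of_bool (S E C D) :: nat)"
      using all_or_none[of C D] D C by auto
  qed
  then show False
    using s_alt[OF C] by simp
qed

section \<open>The hypothetical scheme and its neighbourhoods\<close>

locale scheme_45 = symmetric_association_scheme X "{0..4}" R
  for X :: "'a set" and R :: "nat \<Rightarrow> 'a rel" +
  assumes matrix_0: "intersection_matrix X R 4 0 =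
      [[1, 0, 0, 0, 0],
       [0, 12, 0, 0, 0],
       [0, 0, 4, 0, 0],
       [0, 0, 0, 4, 0],
       [0, 0, 0, 0, 24]]"
    and matrix_1: "intersection_matrix X R 4 1 =
      [[0, 1, 0, 0, 0],
       [1, 3, 2, 0, 6],
       [0, 2, 0, 0, 2],
       [0, 0, 0, 0, 4],
       [0, 6, 2, 4, 12]]"
    and matrix_2: "intersection_matrix X R 4 2 =
      [[0, 0, 1, 0, 0],
       [0, 6, 0, 0, 6],
       [1, 0, 1, 2, 0],
       [0, 0, 2, 2, 0],
       [0, 6, 0, 0, 18]]"
    and matrix_3: "intersection_matrix X R 4 3 =
      [[0, 0, 0, 1, 0],
       [0, 0, 0, 0, 12],
       [0, 0, 2, 2, 0],
       [1, 0, 2, 1, 0],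
       [0, 12, 0, 0, 12]]"
    and matrix_4: "intersection_matrix X R 4 4 =
      [[0, 0, 0, 0, 1],
       [0, 3, 1, 2, 6],
       [0, 1, 0, 0, 3],
       [0, 2, 0, 0, 2],
       [1, 6, 3, 2, 12]]"
begin

definition N :: "nat \<Rightarrow> 'a \<Rightarrow> 'a set" where
  "N i x = R i `` {x}"

text \<open>The simplifier rewrites the index \<open>1\<close> to \<open>Suc 0\<close>, which
  \<open>matrix_1\<close> as stated would no longer match.\<close>

lemmas matrix_Suc_0 = matrix_1[unfolded One_nat_def]

lemma card_N_Int:
  assumes "(x, y) \<in> R h" "h \<le> 4" "i \<le> 4" "j \<le> 4"
  shows "card (N i x \<inter> N j y) = intersection_matrix X R 4 h ! i ! j"
  using card_nbhds_Int[of h i j x y] intersection_number_conv_matrix[of i 4 j X R h] assms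
  by (simp add: N_def)

lemma R_sym: "(x, y) \<in> R i \<Longrightarrow> i \<le> 4 \<Longrightarrow> (y, x) \<in> R i"
  using symmetric[of i] by (auto dest: symD)

lemma R_subset: "i \<le> 4 \<Longrightarrow> R i \<subseteq> X \<times> X"
  using cover by force

lemma R_0_iff: "(x, y) \<in> R 0 \<longleftrightarrow> x \<in> X \<and> x = y"
  using identity by auto

lemma mem_N_iff: "y \<in> N i x \<longleftrightarrow> (x, y) \<in> R i"
  by (simp add: N_def)

lemma N_subset: "i \<le> 4 \<Longrightarrow> N i x \<subseteq> X"
  using R_subset[of i] by (auto simp: mem_N_iff)

lemma finite_N: "i \<le> 4 \<Longrightarrow> finite (N i x)"
  using N_subset finite_vertices finite_subset by metis

lemma R_unique: "(x, y) \<in> R i \<Longrightarrow> (x, y) \<in> R j \<Longrightarrow> i \<le> 4 \<Longrightarrow> j \<le> 4 \<Longrightarrow> i = j"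
  using disjoint by (fastforce simp: disjoint_family_on_def)

lemma R_cases:
  assumes "x \<in> X" "y \<in> X"
  obtains "(x, y) \<in> R 0" | "(x, y) \<in> R 1" | "(x, y) \<in> R 2" | "(x, y) \<in> R 3" | "(x, y) \<in> R 4"
proof -
  obtain i where "i \<in> {0..4}" "(x, y) \<in> R i"
    using cover assms by blast
  moreover have "i = 0 \<or> i = 1 \<or> i = 2 \<or> i = 3 \<or> i = 4"
    using \<open>i \<in> {0..4}\<close> by auto
  ultimately show ?thesis
    using that by blast
qed

lemma card_N:
  assumes "x \<in> X" "i \<le> 4"
  shows "card (N i x) = [1, 12, 4, 4, 24] ! i"
proof -
  have "i = 0 \<or> i = 1 \<or> i = 2 \<or> i = 3 \<or> i = 4"
    using assms(2) by auto
  \<comment> \<open>The valencies are the diagonal entries for \<open>h = 0\<close>, read off at the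
    pair \<open>(x, x)\<close>.\<close>
  moreover have "card (N i x \<inter> N i x) = intersection_matrix X R 4 0 ! i ! i"
    using assms by (intro card_N_Int) (auto simp: R_0_iff)
  ultimately show ?thesis
    by (auto simp: matrix_0)
qed

section \<open>The partition into five blocks of size nine\<close>

definition same_block :: "'a rel" where
  "same_block = R 0 \<union> R 2 \<union> R 3"

text \<open>Each zero entry of a matrix becomes a forbidden triangle.\<close>

lemma not_common_nbr:
  assumes "(x, y) \<in> R h" "h \<le> 4" "i \<le> 4" "j \<le> 4" "intersection_matrix X R 4 h ! i ! j = 0"
    "(x, z) \<in> R i" "(y, z) \<in> R j"
  shows False
proof -
  have "N i x \<inter> N j y = {}"
    using card_N_Int[OF assms(1-4)] assms(3,5) finite_N[of i x] by simp
  then show False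
    using assms(6,7) by (auto simp: mem_N_iff)
qed

lemma same_block_iff:
  assumes "x \<in> X" "y \<in> X"
  shows "(x, y) \<in> same_block \<longleftrightarrow> (x, y) \<notin> R 1 \<union> R 4"
proof
  assume "(x, y) \<in> same_block"
  then show "(x, y) \<notin> R 1 \<union> R 4"
    unfolding same_block_def using R_unique[of x y _ 1] R_unique[of x y _ 4] by fastforce
next
  assume "(x, y) \<notin> R 1 \<union> R 4"
  then show "(x, y) \<in> same_block"
    using R_cases[OF assms] unfolding same_block_def by blast
qed

text \<open>Transitivity holds because \<open>p^h_{ij} = 0\<close> whenever \<open>h\<close> is 1 or
  4 and both \<open>i\<close> and \<open>j\<close> are among 0, 2, 3.\<close>

lemma equiv_same_block: "equiv X same_block"
proof (rule equivI)
  show sub: "same_block \<subseteq> X \<times> X"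
    using R_subset[of 0] R_subset[of 2] R_subset[of 3] by (auto simp: same_block_def)
  show "refl_on X same_block"
    using identity by (auto simp: refl_on_def same_block_def)
  show sym: "sym same_block"
    using R_sym[of _ _ 0] R_sym[of _ _ 2] R_sym[of _ _ 3] by (auto simp: sym_def same_block_def)
  show "trans same_block"
  proof (rule transI, rule ccontr)
    fix x y z assume xy: "(x, y) \<in> same_block" and yz: "(y, z) \<in> same_block"
      and "(x, z) \<notin> same_block"
    moreover have "x \<in> X" "z \<in> X"
      using sub xy yz by auto
    ultimately obtain h where h: "h = 1 \<or> h = 4" "(x, z) \<in> R h"
      using same_block_iff[of x z] by auto
    obtain i where i: "i = 0 \<or> i = 2 \<or> i = 3" "(x, y) \<in> R i"
      using xy by (auto simp: same_block_def)
    have "(z, y) \<in> same_block"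
      using yz sym by (auto dest: symD)
    then obtain j where j: "j = 0 \<or> j = 2 \<or> j = 3" "(z, y) \<in> R j"
      by (auto simp: same_block_def)
    have le: "h \<le> 4" "i \<le> 4" "j \<le> 4"
      using h i j by auto
    have "intersection_matrix X R 4 h ! i ! j = 0"
      using h(1) i(1) j(1) by (auto simp: matrix_Suc_0 matrix_4)
    then show False
      using not_common_nbr[OF h(2) le] i(2) j(2) by blast
  qed
qed

definition blocks :: "'a set set" where
  "blocks = X // same_block"

definition block :: "'a \<Rightarrow> 'a set" where
  "block x = same_block `` {x}"

lemma finite_blocks: "finite blocks"
  unfolding blocks_def using finite_vertices finite_equiv_class
  by (meson equiv_same_block equiv_type finite_quotient)

lemma mem_block: "x \<in> X \<Longrightarrow> x \<in> block x"
  using equiv_class_self[OF equiv_same_block] by (simp add: block_def)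

lemma Union_blocks: "\<Union>blocks = X"
  unfolding blocks_def using equiv_same_block by (rule Union_quotient)

lemma block_eqI: "B \<in> blocks \<Longrightarrow> x \<in> B \<Longrightarrow> block x = B"
  unfolding blocks_def block_def using equiv_same_block
  by (metis Image_singleton_iff equiv_class_eq_iff quotientE)

lemma blocks_disjoint: "B \<in> blocks \<Longrightarrow> C \<in> blocks \<Longrightarrow> B \<noteq> C \<Longrightarrow> B \<inter> C = {}"
  using block_eqI by blast

lemma block_conv_N: "block x = N 0 x \<union> N 2 x \<union> N 3 x"
  by (auto simp: block_def same_block_def N_def)

lemma N_disjoint: "i \<noteq> j \<Longrightarrow> i \<le> 4 \<Longrightarrow> j \<le> 4 \<Longrightarrow> N i x \<inter> N j x = {}"
  using R_unique by (auto simp: mem_N_iff)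

lemma card_block:
  assumes "x \<in> X"
  shows "card (block x) = 9"
  unfolding block_conv_N using assms N_disjoint[of 0 2 x] N_disjoint[of 0 3 x] N_disjoint[of 2 3 x]
  by (simp add: card_Un_disjoint finite_N card_N Int_Un_distrib2)

lemma card_X: "card X = 45"
proof -
  obtain x where "x \<in> X"
    using nonempty[of 0] R_subset[of 0] by auto
  have "X = block x \<union> (N 1 x \<union> N 4 x)"
    unfolding block_conv_N
  proof (intro equalityI subsetI)
    fix y assume "y \<in> X"
    with \<open>x \<in> X\<close> show "y \<in> N 0 x \<union> N 2 x \<union> N 3 x \<union> (N 1 x \<union> N 4 x)"
      by (cases rule: R_cases) (auto simp: mem_N_iff)
  next
    fix y assume "y \<in> N 0 x \<union> N 2 x \<union> N 3 x \<union> (N 1 x \<union> N 4 x)"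
    then show "y \<in> X"
      using N_subset[of 0 x] N_subset[of 1 x] N_subset[of 2 x] N_subset[of 3 x] N_subset[of 4 x]
      by auto
  qed
  moreover have "block x \<inter> (N 1 x \<union> N 4 x) = {}"
    unfolding block_conv_N
    using N_disjoint[of 0 1 x] N_disjoint[of 2 1 x] N_disjoint[of 3 1 x]
      N_disjoint[of 0 4 x] N_disjoint[of 2 4 x] N_disjoint[of 3 4 x] by auto
  moreover have "card (N 1 x \<union> N 4 x) = 36"
    using \<open>x \<in> X\<close> N_disjoint[of 1 4 x] by (simp add: card_Un_disjoint finite_N card_N)
  moreover have "finite (block x)" "finite (N 1 x \<union> N 4 x)"
    by (auto simp: block_conv_N finite_N)
  ultimately show ?thesis
    using card_block[OF \<open>x \<in> X\<close>] by (simp add: card_Un_disjoint)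
qed

lemma block_nonempty: "B \<in> blocks \<Longrightarrow> \<exists>x\<in>X. B = block x"
  by (auto simp: blocks_def block_def quotient_def)

lemma finite_block: "B \<in> blocks \<Longrightarrow> finite B"
  using Union_blocks finite_vertices finite_subset by (metis Union_upper)

lemma card_blocks: "card blocks = 5"
proof -
  have "9 * card blocks = card (\<Union>blocks)"
  proof (rule card_partition)
    show "card B = 9" if "B \<in> blocks" for B
      using card_block block_nonempty[OF that] by auto
  qed (use finite_blocks finite_vertices Union_blocks blocks_disjoint in auto)
  then show ?thesis
    using card_X Union_blocks by simp
qed

text \<open>This distributes the common \<open>R 1\<close>-neighbours of two points over the
  blocks.\<close>

lemma card_conv_blocks:
  assumes "A \<subseteq> X"
  shows "card A = (\<Sum>B\<in>blocks. card (A \<inter> B))"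
proof -
  have "A = (\<Union>B\<in>blocks. A \<inter> B)"
    using assms Union_blocks by auto
  moreover have "card (\<Union>B\<in>blocks. A \<inter> B) = (\<Sum>B\<in>blocks. card (A \<inter> B))"
    using finite_blocks finite_block blocks_disjoint by (intro card_UN_disjoint) auto
  ultimately show ?thesis
    by simp
qed

section \<open>Lines and parallelism inside a block\<close>

definition is_line :: "'a set \<Rightarrow> bool" where
  "is_line L \<longleftrightarrow> card L = 3 \<and> (\<forall>a\<in>L. \<forall>b\<in>L. a \<noteq> b \<longrightarrow> (a, b) \<in> R 2)"

text \<open>Equality is included to make this an equivalence on the lines of one block. Lines of
  different blocks are disjoint anyway, so the notion only carries information within a
  block.\<close>

definition parallel :: "'a set \<Rightarrow> 'a set \<Rightarrow> bool" where
  "parallel L M \<longleftrightarrow> L = M \<or> L \<inter> M = {}"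

lemma is_line_finite: "is_line L \<Longrightarrow> finite L"
  unfolding is_line_def using card.infinite by fastforce

lemma is_line_R_2: "is_line L \<Longrightarrow> a \<in> L \<Longrightarrow> b \<in> L \<Longrightarrow> a \<noteq> b \<Longrightarrow> (a, b) \<in> R 2"
  by (auto simp: is_line_def)

text \<open>As \<open>p^2_{22} = 1\<close>, an \<open>R 2\<close>-edge lies in a single
  \<open>R 2\<close>-triangle, so two points of a line determine the third.\<close>

lemma line_eqI:
  assumes "is_line L" "is_line M" "a \<in> L" "b \<in> L" "a \<in> M" "b \<in> M" "a \<noteq> b"
  shows "L = M"
proof -
  have ab: "(a, b) \<in> R 2"
    using is_line_R_2 assms by blast
  have *: "L = {a, b} \<union> (N 2 a \<inter> N 2 b)" if L: "is_line L" "a \<in> L" "b \<in> L" for L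
  proof -
    have "card (L - {a, b}) = 1"
      using L assms(7) by (simp add: is_line_def card_Diff_subset)
    moreover have "L - {a, b} \<subseteq> N 2 a \<inter> N 2 b"
      using is_line_R_2[OF L(1,2)] is_line_R_2[OF L(1,3)] unfolding mem_N_iff[symmetric] by auto
    moreover have "card (N 2 a \<inter> N 2 b) = 1"
      using card_N_Int[OF ab, of 2 2] by (simp add: matrix_2)
    ultimately have "L - {a, b} = N 2 a \<inter> N 2 b"
      by (intro card_subset_eq) (auto simp: finite_N)
    then show ?thesis
      using L by auto
  qed
  show ?thesis
    using *[of L] *[of M] assms by blast
qed

lemma card_Int_lines:
  assumes "is_line L" "is_line M" "\<not> parallel L M"
  shows "card (L \<inter> M) = 1"
proof -
  obtain a where a: "a \<in> L" "a \<in> M"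
    using assms(3) by (auto simp: parallel_def)
  have "L \<inter> M = {a}"
  proof (rule ccontr)
    assume "L \<inter> M \<noteq> {a}"
    then obtain b where "b \<in> L" "b \<in> M" "a \<noteq> b"
      using a by auto
    with line_eqI[OF assms(1,2)] a assms(3) show False
      by (auto simp: parallel_def)
  qed
  then show ?thesis
    by simp
qed

lemma card_Int_parallel_lines:
  assumes "is_line L" "parallel L M"
  shows "card (L \<inter> M) = (if L = M then 3 else 0)"
  using assms by (auto simp: parallel_def is_line_def)

lemma parallel_sym: "parallel L M \<Longrightarrow> parallel M L"
  by (auto simp: parallel_def)

text \<open>If \<open>L\<close> and \<open>K\<close> met in \<open>p\<close>, they would use up all
  four \<open>R 2\<close>-neighbours of \<open>p\<close>. Then \<open>M\<close>, disjoint from both,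
  would be an \<open>R 2\<close>-triangle among the four \<open>R 3\<close>-neighbours of
  \<open>p\<close>, which \<open>p^3_{32} = 2\<close> rules out.\<close>

lemma parallel_trans:
  assumes lines: "is_line L" "is_line M" "is_line K"
    and block: "B \<in> blocks" "L \<subseteq> B" "M \<subseteq> B" "K \<subseteq> B"
    and par: "parallel L M" "parallel M K"
  shows "parallel L K"
proof (rule ccontr)
  assume npar: "\<not> parallel L K"
  have disj: "L \<inter> M = {}" "M \<inter> K = {}"
    using npar par by (auto simp: parallel_def)
  obtain p where p: "p \<in> L" "p \<in> K"
    using npar by (auto simp: parallel_def)
  have pX: "p \<in> X"
    using p block Union_blocks by blast
  have "L \<union> K - {p} \<subseteq> N 2 p"
    using is_line_R_2[OF lines(1) p(1)] is_line_R_2[OF lines(3) p(2)]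
    unfolding mem_N_iff[symmetric] by auto
  moreover have "card (L \<union> K - {p}) = card (N 2 p)"
    using card_Int_lines[OF lines(1,3) npar] card_Un_Int[of L K] lines p pX
    by (simp add: is_line_finite card_N) (simp add: is_line_def)
  ultimately have N2: "L \<union> K - {p} = N 2 p"
    using finite_N[of 2 p] by (simp add: card_subset_eq)
  have M3: "M \<subseteq> N 3 p"
  proof
    fix q assume q: "q \<in> M"
    then have "q \<in> block p"
      using block_eqI[OF block(1), of p] p block by auto
    then show "q \<in> N 3 p"
      using N2 q p disj by (auto simp: block_conv_N mem_N_iff R_0_iff)
  qed
  have cM: "card M = 3"
    using lines by (simp add: is_line_def)
  have "card (N 3 p - M) = 1"
    using M3 cM pX is_line_finite[OF lines(2)] by (simp add: card_Diff_subset card_N)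
  then obtain w where w: "N 3 p - M = {w}"
    by (auto simp: card_1_singleton_iff)
  have pw: "(p, w) \<in> R 3"
    using w by (auto simp: mem_N_iff[symmetric])
  \<comment> \<open>The fourth \<open>R 3\<close>-neighbour \<open>w\<close> of \<open>p\<close>
    must have an \<open>R 2\<close>-neighbour inside \<open>N 3 p\<close>, and only points of
    \<open>M\<close> are left for it.\<close>
  have "N 3 p \<inter> N 2 w \<noteq> {}"
    using card_N_Int[OF pw, of 3 2] by (auto simp: matrix_3)
  moreover have "w \<notin> N 2 w"
    using pw R_subset[of 3] R_unique[of w w 0 2] by (auto simp: mem_N_iff R_0_iff)
  ultimately obtain q where "q \<in> N 3 p" "q \<in> N 2 w" "q \<noteq> w"
    by auto
  then have q: "q \<in> M" "q \<in> N 2 w"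
    using w by auto
  have pq: "(p, q) \<in> R 3"
    using M3 q by (auto simp: mem_N_iff)
  have "w \<notin> M"
    using w by auto
  \<comment> \<open>Inside \<open>N 3 p\<close>, the point \<open>q\<close> is now
    \<open>R 2\<close>-related to \<open>w\<close> and to the other two points of \<open>M\<close>:
    three points where only two are allowed.\<close>
  have "insert w (M - {q}) \<subseteq> N 3 p \<inter> N 2 q"
    using q w M3 is_line_R_2[OF lines(2)] R_sym[of w q 2] pw by (auto simp: mem_N_iff)
  then have "card (insert w (M - {q})) \<le> card (N 3 p \<inter> N 2 q)"
    by (intro card_mono finite_Int disjI1 finite_N) auto
  moreover have "card (N 3 p \<inter> N 2 q) = 2"
    using card_N_Int[OF pq, of 3 2] by (simp add: matrix_3)
  moreover have "card (insert w (M - {q})) = 3"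
    using cM \<open>w \<notin> M\<close> q is_line_finite[OF lines(2)] by simp
  ultimately show False
    by simp
qed

section \<open>Lines of a block seen from points outside it\<close>

definition line :: "'a set \<Rightarrow> 'a \<Rightarrow> 'a set" where
  "line B x = N 1 x \<inter> B"

lemma R_outside_block:
  assumes "B \<in> blocks" "x \<in> X" "x \<notin> B" "y \<in> B"
  shows "(x, y) \<in> R 1 \<union> R 4"
proof -
  have "x \<notin> block y"
    using assms block_eqI by simp
  then show ?thesis
    using same_block_iff[of y x] assms R_sym[of y x 1] R_sym[of y x 4] Union_blocks
    by (auto simp: block_def)
qed

lemma mem_line_iff: "B \<in> blocks \<Longrightarrow> y \<in> line B x \<longleftrightarrow> y \<in> B \<and> (x, y) \<in> R 1"
  by (auto simp: line_def mem_N_iff)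

lemma same_block_R:
  assumes "B \<in> blocks" "a \<in> B" "b \<in> B" "a \<noteq> b"
  shows "(a, b) \<in> R 2 \<union> R 3"
proof -
  have "b \<in> block a"
    using assms block_eqI by simp
  then show ?thesis
    using assms by (auto simp: block_conv_N mem_N_iff R_0_iff)
qed

text \<open>Two points with a common \<open>R 1\<close>-neighbour cannot be
  \<open>R 3\<close>-related, since \<open>p^3_{11} = 0\<close>; within a block this leaves
  \<open>R 2\<close>. The size is counted from an arbitrary point \<open>y\<close> of
  \<open>B\<close>.\<close>

lemma is_line_line:
  assumes B: "B \<in> blocks" and x: "x \<in> X" "x \<notin> B"
  shows "is_line (line B x)"
proof -
  obtain y where y: "y \<in> X" "B = block y"
    using block_nonempty B by auto
  have "y \<in> B"
    using mem_block y by simp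
  obtain h where h: "h = 1 \<or> h = 4" "(x, y) \<in> R h"
    using R_outside_block[OF B x \<open>y \<in> B\<close>] by auto
  have "line B x = N 1 x \<inter> N 0 y \<union> (N 1 x \<inter> N 2 y \<union> N 1 x \<inter> N 3 y)"
    unfolding line_def y(2) block_conv_N by auto
  also have "card \<dots> = card (N 1 x \<inter> N 0 y) + (card (N 1 x \<inter> N 2 y) + card (N 1 x \<inter> N 3 y))"
    using N_disjoint[of 0 2 y] N_disjoint[of 0 3 y] N_disjoint[of 2 3 y]
    by (subst card_Un_disjoint; (subst card_Un_disjoint)?) (auto simp: finite_N)
  \<comment> \<open>The entries for \<open>j = 0, 2, 3\<close> are 1, 2, 0 if \<open>h = 1\<close>
    and 0, 1, 2 if \<open>h = 4\<close>; both triples add up to 3.\<close>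
  also have "\<dots> = 3"
    using h card_N_Int[OF h(2), of 1 0] card_N_Int[OF h(2), of 1 2] card_N_Int[OF h(2), of 1 3]
    by (auto simp: matrix_Suc_0 matrix_4)
  finally have "card (line B x) = 3" .
  moreover have "(a, b) \<in> R 2" if ab: "a \<in> line B x" "b \<in> line B x" "a \<noteq> b" for a b
  proof (rule ccontr)
    assume "(a, b) \<notin> R 2"
    then have "(a, b) \<in> R 3"
      using same_block_R[OF B, of a b] ab B by (auto simp: mem_line_iff)
    moreover have "(a, x) \<in> R 1" "(b, x) \<in> R 1"
      using ab B R_sym[of x _ 1] by (auto simp: mem_line_iff)
    ultimately show False
      using not_common_nbr[of a b 3 1 1 x] by (auto simp: matrix_3)
  qed
  ultimately show ?thesis
    by (auto simp: is_line_def)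
qed

lemma line_subset: "line B x \<subseteq> B"
  by (auto simp: line_def)

lemma parallel_line_R_3:
  assumes "(x, y) \<in> R 3"
  shows "parallel (line B x) (line B y)"
proof -
  have "N 1 x \<inter> N 1 y = {}"
    using not_common_nbr[OF assms, of 1 1] by (auto simp: mem_N_iff matrix_3)
  then show ?thesis
    unfolding parallel_def line_def by blast
qed

text \<open>Distinct points of a block are joined by a path of at most two \<open>R 3\<close>-edges, and the lines
  seen from \<open>R 3\<close>-related points are disjoint.\<close>

lemma parallel_line_same_block:
  assumes B: "B \<in> blocks" and D: "D \<in> blocks" "D \<noteq> B" "x \<in> D" "y \<in> D"
  shows "parallel (line B x) (line B y)"
proof -
  have X: "x \<in> X" "x \<notin> B" "y \<in> X" "y \<notin> B"
    using assms Union_blocks blocks_disjoint[of B D] by auto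
  consider "x = y" | "(x, y) \<in> R 3" | "(x, y) \<in> R 2"
    using same_block_R[OF D(1,3,4)] by auto
  then show ?thesis
  proof cases
    case 1
    then show ?thesis by (simp add: parallel_def)
  next
    case 2
    then show ?thesis by (rule parallel_line_R_3)
  next
    case 3
    then have "card (N 3 x \<inter> N 3 y) = 2"
      using card_N_Int[OF 3, of 3 3] by (simp add: matrix_2)
    then obtain z where z: "(x, z) \<in> R 3" "(y, z) \<in> R 3"
      by (metis Int_iff card.empty equals0I mem_N_iff zero_neq_numeral)
    have "z \<in> block x"
      using z by (auto simp: block_conv_N mem_N_iff)
    then have "z \<in> D"
      using block_eqI D by auto
    then have zX: "z \<in> X" "z \<notin> B"
      using Union_blocks blocks_disjoint[OF B D(1)] D by auto
    show ?thesis
      using parallel_trans[OF is_line_line[OF B X(1,2)] is_line_line[OF B zX]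
          is_line_line[OF B X(3,4)] B line_subset line_subset line_subset]
        parallel_line_R_3[OF z(1)] parallel_sym[OF parallel_line_R_3[OF z(2)]] by blast
  qed
qed

section \<open>Directions of blocks and the two counts\<close>

definition same_direction :: "'a set \<Rightarrow> 'a set \<Rightarrow> 'a set \<Rightarrow> bool" where
  "same_direction E C D \<longleftrightarrow> (\<exists>x\<in>C. \<exists>y\<in>D. parallel (line E x) (line E y))"

text \<open>The choice of representatives is immaterial: all points of one block see parallel lines
  in \<open>E\<close>, and parallelism within \<open>E\<close> is transitive.\<close>

lemma same_direction_iff:
  assumes "C \<in> blocks" "D \<in> blocks" "E \<in> blocks" "C \<noteq> E" "D \<noteq> E" "x \<in> C" "y \<in> D"
  shows "same_direction E C D \<longleftrightarrow> parallel (line E x) (line E y)"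
proof
  assume "same_direction E C D"
  then obtain x' y' where xy: "x' \<in> C" "y' \<in> D" "parallel (line E x') (line E y')"
    by (auto simp: same_direction_def)
  have C: "is_line (line E z)" if "z \<in> C" for z
    using assms that Union_blocks blocks_disjoint[of C E] by (intro is_line_line) auto
  have D: "is_line (line E z)" if "z \<in> D" for z
    using assms that Union_blocks blocks_disjoint[of D E] by (intro is_line_line) auto
  have "parallel (line E x) (line E x')" "parallel (line E y') (line E y)"
    using assms xy parallel_line_same_block by auto
  then show "parallel (line E x) (line E y)"
    using parallel_trans[OF _ _ _ assms(3) line_subset line_subset line_subset] xy C D assms(6,7)
    by meson
qed (use assms in \<open>auto simp: same_direction_def\<close>)

lemma N_1_Int_block:
  assumes "B \<in> blocks" "x \<in> B"
  shows "N 1 x \<inter> B = {}"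
proof -
  have "B = block x"
    using block_eqI assms by simp
  then show ?thesis
    using N_disjoint[of 1 0 x] N_disjoint[of 1 2 x] N_disjoint[of 1 3 x] by (auto simp: block_conv_N)
qed

text \<open>Any \<open>x \<in> C\<close> and \<open>y \<in> D\<close> have three common \<open>R 1\<close>-neighbours. A block \<open>E\<close> holds
  exactly one of them, unless \<open>C\<close> and \<open>D\<close> have the same direction in \<open>E\<close>; then it holds none or
  three.\<close>

lemma card_same_direction_blocks:
  assumes "C \<in> blocks" "D \<in> blocks" "C \<noteq> D"
  shows "card {E \<in> blocks - {C} - {D}. same_direction E C D} \<in> {0, 3}"
proof -
  let ?V = "blocks - {C} - {D}"
  obtain x y where xy: "x \<in> X" "y \<in> X" "x \<in> C" "y \<in> D"
    using block_nonempty mem_block assms by metis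
  have "x \<notin> D"
    using blocks_disjoint assms xy by auto
  then obtain h where h: "h = 1 \<or> h = 4" "(x, y) \<in> R h"
    using R_outside_block[of D x y] assms xy by auto
  let ?f = "\<lambda>E. card (line E x \<inter> line E y)"
  have "card (N 1 x \<inter> N 1 y) = 3"
    using h card_N_Int[OF h(2), of 1 1] by (auto simp: matrix_Suc_0 matrix_4)
  then have "(\<Sum>E\<in>blocks. ?f E) = 3"
    using card_conv_blocks[of "N 1 x \<inter> N 1 y"] N_subset[of 1 x]
    by (simp add: line_def Int_ac le_infI1)
  moreover have "?f C = 0" "?f D = 0"
    using N_1_Int_block assms xy by (auto simp: line_def)
  ultimately have sum: "(\<Sum>E\<in>?V. ?f E) = 3"
    using finite_blocks assms by (simp add: sum_diff1_nat)
  have card: "card ?V = 3"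
    using finite_blocks card_blocks assms by simp
  have outside: "E \<in> blocks" "C \<noteq> E" "D \<noteq> E" "x \<notin> E" "y \<notin> E" if "E \<in> ?V" for E
    using that assms xy blocks_disjoint[of C E] blocks_disjoint[of D E] by blast+
  have par: "same_direction E C D \<longleftrightarrow> parallel (line E x) (line E y)"
    and lines: "is_line (line E x)" "is_line (line E y)" if "E \<in> ?V" for E
    using same_direction_iff is_line_line assms(1,2) xy outside[OF that] by simp_all
  have f_same: "?f E \<in> {0, 3}" if "E \<in> ?V" "same_direction E C D" for E
    using card_Int_parallel_lines[OF lines(1)] par that by simp
  have f_diff: "?f E = 1" if "E \<in> ?V" "\<not> same_direction E C D" for E
    using card_Int_lines[OF lines] par that by simp
  define S where "S = {E \<in> ?V. same_direction E C D}"
  define T where "T = ?V - S"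
  have ST: "?V = S \<union> T" "S \<inter> T = {}" "finite S" "finite T"
    using finite_blocks by (auto simp: S_def T_def)
  have "card S + card T = 3"
    using card card_Un_disjoint[OF ST(3,4,2)] ST(1) by simp
  moreover have "(\<Sum>E\<in>S. ?f E) + (\<Sum>E\<in>T. ?f E) = 3"
    using sum.union_disjoint[OF ST(3,4,2), of ?f] sum unfolding ST(1) by simp
  moreover have "(\<Sum>E\<in>T. ?f E) = (\<Sum>E\<in>T. 1)"
    by (rule sum.cong[OF refl], rule f_diff) (auto simp: S_def T_def)
  moreover have "3 dvd (\<Sum>E\<in>S. ?f E)"
    using f_same by (intro dvd_sum) (force simp: S_def)
  \<comment> \<open>Blocks in \<open>T\<close> contribute 1 each, so comparing the two totals of 3
    gives \<open>S\<close> an average contribution of 1. As its contributions are multiples of 3,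
    \<open>card S\<close> is a multiple of 3 as well.\<close>
  ultimately have "card S \<le> 3" "(\<Sum>E\<in>S. ?f E) = card S" "3 dvd (\<Sum>E\<in>S. ?f E)"
    by simp_all
  then have "card S = 0 \<or> card S = 3"
    by auto
  then show ?thesis
    by (simp add: S_def)
qed

text \<open>Let \<open>a\<close>, \<open>b\<close> be two points of the line of \<open>E\<close> seen from a point of \<open>C\<close>. A block \<open>D\<close> has the
  same direction as \<open>C\<close> iff \<open>a\<close> and \<open>b\<close> see the same line of \<open>D\<close>; as \<open>a\<close> and \<open>b\<close> have six common
  \<open>R 1\<close>-neighbours, this happens for two blocks, one of which is \<open>C\<close>.\<close>

lemma card_same_direction_partner:
  assumes "C \<in> blocks" "E \<in> blocks" "C \<noteq> E"
  shows "card {D \<in> blocks - {E} - {C}. same_direction E C D} = 1"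
proof -
  obtain c where c: "c \<in> X" "c \<in> C"
    using block_nonempty mem_block assms by metis
  have "c \<notin> E"
    using blocks_disjoint assms c by auto
  have line_c: "is_line (line E c)"
    using is_line_line assms c \<open>c \<notin> E\<close> by simp
  then have "card (line E c) = 3"
    by (simp add: is_line_def)
  then obtain a b where ab: "a \<in> line E c" "b \<in> line E c" "a \<noteq> b"
    by (metis card_3_iff insertCI)
  have abE: "a \<in> E" "b \<in> E"
    using ab by (auto simp: line_def)
  have ab2: "(a, b) \<in> R 2"
    using is_line_R_2 line_c ab by blast
  let ?f = "\<lambda>D. card (line D a \<inter> line D b)"
  have "card (N 1 a \<inter> N 1 b) = 6"
    using card_N_Int[OF ab2, of 1 1] by (simp add: matrix_2)
  then have "(\<Sum>D\<in>blocks. ?f D) = 6"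
    using card_conv_blocks[of "N 1 a \<inter> N 1 b"] N_subset[of 1 a]
    by (simp add: line_def Int_ac le_infI1)
  moreover have "?f E = 0"
    using N_1_Int_block assms abE by (auto simp: line_def)
  ultimately have "(\<Sum>D\<in>blocks - {E}. ?f D) = 6"
    using finite_blocks assms by (simp add: sum_diff1_nat)
  moreover have f: "?f D = (if same_direction E C D then 3 else 0)" if D: "D \<in> blocks - {E}" for D
  proof -
    have abX: "a \<in> X" "a \<notin> D" "b \<in> X" "b \<notin> D"
      using D abE assms Union_blocks blocks_disjoint[of D E] by auto
    have par: "parallel (line D a) (line D b)"
      using parallel_line_same_block D abE assms by auto
    have line_a: "is_line (line D a)"
      using is_line_line D abX by auto
    \<comment> \<open>Taking the representative \<open>d\<close> of \<open>D\<close> on the line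
      seen from \<open>a\<close> puts \<open>a\<close> on \<open>line E d\<close>. Thus
      \<open>line E c\<close> and \<open>line E d\<close> meet in \<open>a\<close>, and they are
      parallel only if equal.\<close>
    then obtain d where d: "d \<in> line D a"
      by (fastforce simp: is_line_def)
    have dD: "d \<in> D" "d \<in> X" "d \<notin> E" and da: "(d, a) \<in> R 1"
      using d D Union_blocks blocks_disjoint[of D E] assms R_sym[of a d 1]
      by (auto simp: line_def mem_N_iff)
    have line_d: "is_line (line E d)"
      using is_line_line assms dD by simp
    have a_d: "a \<in> line E d"
      using da abE by (simp add: line_def mem_N_iff)
    have "same_direction E C D \<longleftrightarrow> parallel (line E c) (line E d)"
      using same_direction_iff D assms c dD by auto
    also have "\<dots> \<longleftrightarrow> line E c = line E d"
      using a_d ab by (auto simp: parallel_def)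
    also have "\<dots> \<longleftrightarrow> b \<in> line E d"
      using line_eqI[OF line_c line_d] a_d ab by auto
    \<comment> \<open>Symmetry of \<open>R 1\<close> exchanges the roles of \<open>D\<close> and
      \<open>E\<close>: incidence in \<open>E\<close> becomes incidence in \<open>D\<close>.\<close>
    also have "\<dots> \<longleftrightarrow> d \<in> line D b"
      using R_sym[of b d 1] R_sym[of d b 1] abE dD by (auto simp: line_def mem_N_iff)
    also have "\<dots> \<longleftrightarrow> line D a = line D b"
      using par d by (auto simp: parallel_def)
    finally show ?thesis
      using card_Int_parallel_lines[OF line_a par] by simp
  qed
  ultimately have "(\<Sum>D\<in>blocks - {E}. if same_direction E C D then 3 else 0) = (6 :: nat)"
    by simp
  then have "3 * card {D \<in> blocks - {E}. same_direction E C D} = 6"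
    using finite_blocks by (simp add: sum.If_cases Int_def)
  \<comment> \<open>The two blocks found include \<open>C\<close> itself, which has to be discarded
    to leave its single partner.\<close>
  moreover have "C \<in> {D \<in> blocks - {E}. same_direction E C D}"
    using assms c by (auto simp: same_direction_def parallel_def)
  moreover have "{D \<in> blocks - {E} - {C}. same_direction E C D} =
      {D \<in> blocks - {E}. same_direction E C D} - {C}"
    by auto
  ultimately show ?thesis
    using finite_blocks by simp
qed

lemma contradiction: False
proof (rule no_pairing_system_on_five_points[where V = blocks and S = same_direction])
  show "card blocks = 5"
    by (rule card_blocks)
  show "card {D \<in> blocks - {E} - {C}. same_direction E C D} = 1"
    if "C \<in> blocks" "E \<in> blocks" "C \<noteq> E" for C E
    using that by (rule card_same_direction_partner)
  show "card {E \<in> blocks - {C} - {D}. same_direction E C D} \<in> {0, 3}"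
    if "C \<in> blocks" "D \<in> blocks" "C \<noteq> D" for C D
    using that by (rule card_same_direction_blocks)
qed

end

theorem theorem5p2:
  shows "\<not> (\<exists>(X :: 'a set) (R :: nat \<Rightarrow> 'a rel).
    symmetric_association_scheme X {0..4} R \<and>
    intersection_matrix X R 4 0 =
      [[1, 0, 0, 0, 0],
       [0, 12, 0, 0, 0],
       [0, 0, 4, 0, 0],
       [0, 0, 0, 4, 0],
       [0, 0, 0, 0, 24]] \<and>
    intersection_matrix X R 4 1 =
      [[0, 1, 0, 0, 0],
       [1, 3, 2, 0, 6],
       [0, 2, 0, 0, 2],
       [0, 0, 0, 0, 4],
       [0, 6, 2, 4, 12]] \<and>
    intersection_matrix X R 4 2 =
      [[0, 0, 1, 0, 0],
       [0, 6, 0, 0, 6],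
       [1, 0, 1, 2, 0],
       [0, 0, 2, 2, 0],
       [0, 6, 0, 0, 18]] \<and>
    intersection_matrix X R 4 3 =
      [[0, 0, 0, 1, 0],
       [0, 0, 0, 0, 12],
       [0, 0, 2, 2, 0],
       [1, 0, 2, 1, 0],
       [0, 12, 0, 0, 12]] \<and>
    intersection_matrix X R 4 4 =
      [[0, 0, 0, 0, 1],
       [0, 3, 1, 2, 6],
       [0, 1, 0, 0, 3],
       [0, 2, 0, 0, 2],
       [1, 6, 3, 2, 12]])"
proof (rule notI, elim exE conjE, goal_cases)
  case (1 X R)
  then have "scheme_45 X R"
    by (intro scheme_45.intro scheme_45_axioms.intro)
  then show False
    by (rule scheme_45.contradiction)
qed

end
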